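(* For an integer $k\ge 2$, let $L_{\mathrm{bal}}(k;2)$ be the largest positive integer $n$ for which there exists a coloring of $\{1,\ldots,n\}$ with two colors such that the two color classes have sizes differing by at most one and neither color class contains $k$ pairwise coprime integers. Then for every $k\ge2$, \[ L_{\mathrm{bal}}(k;2)=p_{2k-2}-1, \] where $p_m$ is the $m$-th prime ($p_1=2$).
   Context: A set of pairwise coprime integers means a set of distinct positive integers any two of which have greatest common divisor $1$. *)

theory Defs
  imports Complex_Main "HOL-Library.Infinite_Set" "HOL-Computational_Algebra.Primes"
begin

text \<open>The library function \<open>enumerate\<close> counts from 0, whereas the first prime here is
  \<open>nth_prime 1 = 2\<close>; the value at index 0 is junk.\<close>
definition nth_prime :: "nat \<Rightarrow> nat" where
  "nth_prime m = enumerate {p. prime p} (m - 1)"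

definition color_class :: "(nat \<Rightarrow> 'c) \<Rightarrow> nat \<Rightarrow> 'c \<Rightarrow> nat set" where
  "color_class c n i = {x \<in> {1..n}. c x = i}"

definition contains_pairwise_coprime :: "nat \<Rightarrow> nat set \<Rightarrow> bool" where
  "contains_pairwise_coprime k A \<longleftrightarrow> (\<exists>S \<subseteq> A. finite S \<and> card S = k \<and> pairwise coprime S)"

definition balanced_coloring :: "nat \<Rightarrow> (nat \<Rightarrow> bool) \<Rightarrow> bool" where
  "balanced_coloring n c \<longleftrightarrow>
     \<bar>int (card (color_class c n True)) - int (card (color_class c n False))\<bar> \<le> 1"

definition bal_admissible :: "nat \<Rightarrow> nat set" where
  "bal_admissible k = {n. n \<ge> 1 \<and> (\<exists>c :: nat \<Rightarrow> bool. balanced_coloring n c \<and>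
     (\<forall>i. \<not> contains_pairwise_coprime k (color_class c n i)))}"

text \<open>\<open>Max\<close> is the largest element only for a finite nonempty set, so statements about \<open>L_bal\<close>
  should come together with these two properties of \<open>bal_admissible k\<close>.\<close>
definition L_bal :: "nat \<Rightarrow> nat" where
  "L_bal k = Max (bal_admissible k)"

end

theory Submission imports Defs begin

text \<open>
  Upper bound: \<open>1\<close> and the first \<open>2k - 2\<close> primes are \<open>2k - 1\<close> pairwise coprime numbers, so one
  colour receives \<open>k\<close> of them.
  Lower bound: let \<open>n = p\<^bsub>2k-2\<^esub> - 1\<close>, and split the \<open>2k - 3\<close> primes up to \<open>n\<close> into \<open>k - 1\<close> primes
  \<open>P\<close> and \<open>k - 2\<close> primes \<open>Q\<close>. If one class consists of multiples of members of \<open>P\<close> and the other of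
  \<open>1\<close> and multiples of members of \<open>Q\<close>, neither contains \<open>k\<close> pairwise coprime numbers. Numbers with
  prime factors of both kinds may go to either class, so balance can be achieved as soon as neither
  class is forced to have more than half of the numbers. For \<open>k \<ge> 3\<close> this is ensured by \<open>2 \<in> Q\<close> and by
  putting \<open>3, 5, 7\<close> (those up to \<open>n\<close>) into \<open>P\<close>, because at least \<open>n div 2\<close> of the numbers up to
  \<open>n \<ge> 5\<close> have a divisor among \<open>3, 5, 7\<close>.
\<close>

section \<open>Counting the primes below the m-th prime\<close>

lemma card_less_enumerate:
  fixes S :: "nat set"
  assumes "infinite S"
  shows "card {x \<in> S. x < enumerate S m} = m"
proof -
  have "{x \<in> S. x < enumerate S m} = enumerate S ` {..<m}"
    using assms by (auto simp: enumerate_in_set) (metis enumerate_Ex enumerate_mono_iff imageI lessThan_iff)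
  moreover have "inj_on (enumerate S) {..<m}"
    using inj_enumerate[OF assms] by (rule inj_on_subset) simp
  ultimately show ?thesis by (simp add: card_image)
qed

lemma prime_nth_prime: "prime (nth_prime m)"
  using enumerate_in_set[OF primes_infinite] by (auto simp: nth_prime_def)

lemma card_primes_less_nth_prime: "card {p. prime p \<and> p < nth_prime m} = m - 1"
  using card_less_enumerate[OF primes_infinite] by (simp add: nth_prime_def)

section \<open>Colour classes covered by few primes\<close>

text \<open>Sending each element to one of its prime divisors in \<open>P\<close> is injective,
  since coprime numbers share no prime.\<close>

lemma pairwise_coprime_card_le:
  fixes S P :: "nat set"
  assumes "pairwise coprime S" "finite P" "\<And>p. p \<in> P \<Longrightarrow> prime p"
    and "\<And>x. x \<in> S \<Longrightarrow> \<exists>p\<in>P. p dvd x"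
  shows "card S \<le> card P"
proof -
  obtain f where f: "\<And>x. x \<in> S \<Longrightarrow> f x \<in> P \<and> f x dvd x"
    using assms(4) by metis
  have "inj_on f S"
  proof (rule inj_onI, rule ccontr)
    fix x y assume "x \<in> S" "y \<in> S" "f x = f y" "x \<noteq> y"
    then have "coprime x y" "f x dvd x" "f x dvd y" "prime (f x)"
      using assms(1,3) f by (auto simp: pairwise_def) (metis f)
    then show False
      using not_coprimeI not_prime_unit by blast
  qed
  then show ?thesis
    using f assms(2) by (meson card_inj_on_le image_subsetI)
qed

text \<open>The set in \<open>A\<close> is forced into the \<open>P\<close>-class, and the set in
  \<open>B\<close> is all that this class may hold. The two bounds leave room for a class of exactly
  \<open>n div 2\<close> numbers in between.\<close>

lemma bal_admissibleI:
  fixes P Q :: "nat set"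
  assumes "n \<ge> 1" "finite P" "finite Q" "\<And>p. p \<in> P \<union> Q \<Longrightarrow> prime p"
    and cover: "\<And>p. prime p \<Longrightarrow> p \<le> n \<Longrightarrow> p \<in> P \<union> Q"
    and cards: "card P < k" "card Q + 1 < k"
    and A: "card {x \<in> {2..n}. \<forall>q\<in>Q. \<not> q dvd x} \<le> n div 2"
    and B: "n div 2 \<le> card {x \<in> {1..n}. \<exists>p\<in>P. p dvd x}"
  shows "n \<in> bal_admissible k"
proof -
  let ?A = "{x \<in> {2..n}. \<forall>q\<in>Q. \<not> q dvd x}" and ?B = "{x \<in> {1..n}. \<exists>p\<in>P. p dvd x}"
  have ex: "\<exists>p\<in>P \<union> Q. p dvd x" if "x \<in> {2..n}" for x
  proof -
    obtain p where "prime p" "p dvd x"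
      using \<open>x \<in> {2..n}\<close> prime_factor_nat[of x] by auto
    moreover have "p \<le> n"
      using \<open>p dvd x\<close> that by (auto dest: dvd_imp_le)
    ultimately show ?thesis using cover by blast
  qed
  then have "?A \<subseteq> ?B"
    by fastforce
  then obtain S where S: "?A \<subseteq> S" "S \<subseteq> ?B" "card S = n div 2"
    using exists_subset_between[of ?A "n div 2" ?B] A B by auto
  define c where "c = (\<lambda>x. x \<in> S)"
  have T: "color_class c n True = S" and F: "color_class c n False = {1..n} - S"
    using S(2) by (auto simp: color_class_def c_def)
  have "card ({1..n} - S) = n - n div 2"
    using S by (subst card_Diff_subset) (auto intro: finite_subset[OF S(2)])
  then have "balanced_coloring n c"
    by (simp add: balanced_coloring_def T F S(3))
  moreover have "\<not> contains_pairwise_coprime k S"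
  proof
    assume "contains_pairwise_coprime k S"
    then obtain U where U: "U \<subseteq> S" "card U = k" "pairwise coprime U"
      by (auto simp: contains_pairwise_coprime_def)
    have "card U \<le> card P"
      using U S(2) assms(2,4) by (intro pairwise_coprime_card_le) auto
    then show False using U cards by simp
  qed
  moreover have "\<not> contains_pairwise_coprime k ({1..n} - S)"
  proof
    assume "contains_pairwise_coprime k ({1..n} - S)"
    then obtain U where U: "U \<subseteq> {1..n} - S" "finite U" "card U = k" "pairwise coprime U"
      by (auto simp: contains_pairwise_coprime_def)
    \<comment> \<open>The number 1 has no prime divisor, so it is set aside; this accounts for the
      \<open>+ 1\<close> in the bound on \<open>card Q\<close>.\<close>
    have "card (U - {1}) \<le> card Q"
    proof (rule pairwise_coprime_card_le)
      show "pairwise coprime (U - {1})"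
        using U(4) by (rule pairwise_subset) auto
      fix x assume x: "x \<in> U - {1}"
      then have "x \<in> {1..n}" "x \<noteq> 1" "x \<notin> ?A"
        using U(1) S(1) by auto
      then show "\<exists>q\<in>Q. q dvd x"
        by auto
    qed (use assms in auto)
    moreover have "card U \<le> card (U - {1}) + 1"
      using U(2) by (simp add: card_Diff_singleton_if) linarith
    ultimately show False using U cards by simp
  qed
  ultimately have "balanced_coloring n c \<and> (\<forall>i. \<not> contains_pairwise_coprime k (color_class c n i))"
    using T F by (metis (full_types))
  then show ?thesis
    using \<open>n \<ge> 1\<close> by (auto simp: bal_admissible_def)
qed

section \<open>Odd numbers and multiples of 3, 5, 7\<close>

text \<open>Starting at 2 matters: with 1 included, the bound would fail for odd
  \<open>n\<close>.\<close>

lemma card_odd_from_2: "card {x \<in> {2..n}. odd x} \<le> n div 2"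
proof -
  have "{x \<in> {2..n}. odd x} \<subseteq> (\<lambda>i. 2 * i + 1) ` {1..<(n + 1) div 2}"
    by (auto elim!: oddE)
  from card_mono[OF _ this] have "card {x \<in> {2..n}. odd x} \<le> card ((\<lambda>i. 2 * i + 1) ` {1..<(n + 1) div 2})"
    by simp
  also have "\<dots> \<le> (n + 1) div 2 - 1"
    using card_image_le[of "{1..<(n + 1) div 2}" "\<lambda>i. 2 * i + 1"] by simp
  finally show ?thesis by linarith
qed

text \<open>Inclusion-exclusion, with the negative terms moved to the left to avoid subtraction on
  \<open>nat\<close>. In the induction each quotient grows by a divisibility indicator.\<close>

lemma card_divisible_3_5_7_eq:
  "card {x \<in> {1..n}. 3 dvd x \<or> 5 dvd x \<or> 7 dvd x} + n div 15 + n div 21 + n div 35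
    = n div 3 + n div 5 + n div 7 + n div 105" for n :: nat
proof (induction n)
  case 0
  then show ?case by simp
next
  case (Suc n)
  define D where "D = (\<lambda>x::nat. 3 dvd x \<or> 5 dvd x \<or> 7 dvd x)"
  have split: "{x \<in> {1..Suc n}. D x} = (if D (Suc n) then insert (Suc n) else id) {x \<in> {1..n}. D x}"
    by (auto simp: le_Suc_eq)
  have card_Suc: "card {x \<in> {1..Suc n}. D x} = card {x \<in> {1..n}. D x} + of_bool (D (Suc n))"
    unfolding split by simp
  have div: "Suc n div d = n div d + of_bool (d dvd Suc n)" for d
    by (simp add: div_Suc dvd_eq_mod_eq_0)
  \<comment> \<open>Turns divisibility by 15, 21, 35 and 105 into conjunctions, so that only a
    Boolean identity in three variables remains.\<close>
  have dvd_mult: "a * b dvd x \<longleftrightarrow> a dvd x \<and> b dvd x" if "coprime a b" for a b x :: nat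
    using that by (auto intro: divides_mult dvd_mult_left dvd_mult_right)
  have coprime: "coprime 3 (5::nat)" "coprime 3 (7::nat)" "coprime 5 (7::nat)" "coprime 15 (7::nat)"
    by (simp_all add: coprime_iff_gcd_eq_1 gcd_non_0_nat)
  note dvd_iff = coprime[THEN dvd_mult, simplified]
  have incl_excl: "(of_bool (a \<or> b \<or> c) :: nat) + of_bool (a \<and> b) + of_bool (a \<and> c) + of_bool (b \<and> c)
      = of_bool a + of_bool b + of_bool c + of_bool ((a \<and> b) \<and> c)" for a b c
    by (cases a; cases b; cases c) simp_all
  show ?case
    using Suc.IH card_Suc incl_excl[of "3 dvd Suc n" "5 dvd Suc n" "7 dvd Suc n"]
    unfolding div dvd_iff D_def by linarith
qed

text \<open>In each period of 105 numbers, 57 have a divisor among 3, 5, 7, which is more than half;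
  a finite check covers the start.\<close>

lemma card_divisible_3_5_7:
  fixes n :: nat
  assumes "n \<ge> 5"
  shows "n div 2 \<le> card {x \<in> {1..n}. 3 dvd x \<or> 5 dvd x \<or> 7 dvd x}"
proof -
  have "n div 2 + n div 15 + n div 21 + n div 35 \<le> n div 3 + n div 5 + n div 7 + n div 105"
    using assms
  proof (induction n rule: less_induct)
    case (less n)
    show ?case
    \<comment> \<open>As 110 = 5 + 105, every larger \<open>n\<close> can be lowered by a full
      period and stay at least 5.\<close>
    proof (cases "n < 110")
      case True
      have "\<forall>n\<in>set [5..<110]. n div 2 + n div 15 + n div 21 + n div 35
          \<le> n div 3 + n div 5 + n div 7 + n div (105::nat)"
        by simp
      then show ?thesis using True less.prems by (metis atLeastLessThan_iff set_upt)
    next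
      case False
      define m where "m = n - 105"
      have m: "n = m + 105" "m \<ge> 5" "m < n" using False by (auto simp: m_def)
      have "(m + 105) div 3 = m div 3 + 35" "(m + 105) div 5 = m div 5 + 21"
        "(m + 105) div 7 = m div 7 + 15" "(m + 105) div 15 = m div 15 + 7"
        "(m + 105) div 21 = m div 21 + 5" "(m + 105) div 35 = m div 35 + 3"
        "(m + 105) div 105 = m div 105 + 1" "(m + 105) div 2 \<le> m div 2 + 53"
        by linarith+
      \<comment> \<open>The left side grows by at most 53 + 7 + 5 + 3 = 68, the right side by 35 +
        21 + 15 + 1 = 72.\<close>
      with less.IH[OF m(3,2)] show ?thesis unfolding m(1) by linarith
    qed
  qed
  with card_divisible_3_5_7_eq[of n] show ?thesis by linarith
qed

section \<open>Lower bound\<close>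

lemma pred_nth_prime_bal_admissible:
  assumes "k \<ge> 2"
  shows "nth_prime (2 * k - 2) - 1 \<in> bal_admissible k"
proof -
  define n where "n = nth_prime (2 * k - 2) - 1"
  have n1: "n \<ge> 1"
    using prime_ge_2_nat[OF prime_nth_prime, of "2 * k - 2"] by (simp add: n_def)
  define R where "R = {p. prime p \<and> p \<le> n}"
  have "R = {p. prime p \<and> p < nth_prime (2 * k - 2)}"
    using n1 by (auto simp: R_def n_def)
  then have cR: "card R = 2 * k - 3"
    using card_primes_less_nth_prime[of "2 * k - 2"] by simp
  have fR: "finite R" by (simp add: R_def)
  have pr: "prime (2::nat)" "prime (3::nat)" "prime (5::nat)" "prime (7::nat)"
    by simp_all
  have "n \<in> bal_admissible k"
  proof (cases "k = 2")
    \<comment> \<open>Here \<open>Q\<close> must be empty, so 2 goes into \<open>P\<close> instead;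
      the only prime up to \<open>n\<close> is 2, whence \<open>n = 2\<close>.\<close>
    case True
    have "R \<noteq> {}" using cR True by auto
    then have "n \<ge> 2" unfolding R_def using prime_ge_2_nat order_trans by blast
    moreover have "\<not> n \<ge> 3"
    proof
      assume "n \<ge> 3"
      then have "{2, 3} \<subseteq> R" using pr by (auto simp: R_def)
      from card_mono[OF fR this] show False using cR True by simp
    qed
    ultimately have n2: "n = 2" by simp
    have A: "{x \<in> {2..2::nat}. \<forall>q\<in>{}. \<not> q dvd x} = {2}"
      and B: "{x \<in> {1..2::nat}. \<exists>p\<in>{2}. p dvd x} = {2}"
      by (auto dest: dvd_imp_le)
    have "2 \<in> bal_admissible 2"
    proof (rule bal_admissibleI[of 2 "{2}" "{}"])
      fix p :: nat assume "prime p" "p \<le> 2"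
      then show "p \<in> {2} \<union> {}" using prime_ge_2_nat[of p] by simp
    qed (simp_all only: A B, simp_all)
    then show ?thesis by (simp only: n2 True)
  next
    case False
    with assms have k3: "k \<ge> 3" by simp
    have n5: "n \<ge> 5"
    proof (rule ccontr)
      assume "\<not> n \<ge> 5"
      have "R \<subseteq> {2, 3}"
      proof
        fix p assume "p \<in> R"
        then have "prime p" "p = 2 \<or> p = 3 \<or> p = 4"
          using \<open>\<not> n \<ge> 5\<close> prime_ge_2_nat[of p] by (auto simp: R_def)
        moreover have "\<not> prime (4::nat)" by simp
        ultimately show "p \<in> {2, 3}" by auto
      qed
      from card_mono[OF _ this] show False using cR k3 by simp
    qed
    have c7: "card {3, 5, 7::nat} = 3" by simp
    define T where "T = {3, 5, 7} \<inter> R"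
    \<comment> \<open>\<open>T\<close> has to fit into \<open>P\<close>. For \<open>k = 3\<close>
      only two places are available, but then the three primes up to \<open>n\<close> cannot include
      7.\<close>
    have "card T \<le> k - 1"
    proof (cases "k = 3")
      case True
      have "\<not> n \<ge> 7"
      proof
        assume "n \<ge> 7"
        then have "{2, 3, 5, 7} \<subseteq> R" using pr by (auto simp: R_def)
        from card_mono[OF fR this] show False using cR True by simp
      qed
      then have "T \<subseteq> {3, 5}" by (auto simp: T_def R_def)
      from card_mono[OF _ this] show ?thesis using True by simp
    next
      case False
      have "card T \<le> card {3, 5, 7::nat}" by (rule card_mono) (auto simp: T_def)
      then show ?thesis using False k3 c7 by linarith
    qed
    moreover have "2 \<in> R" using n5 pr by (simp add: R_def)
    then have "card (R - {2}) = 2 * k - 4" using fR cR by simp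
    then have "k - 1 \<le> card (R - {2})" using k3 by linarith
    moreover have "T \<subseteq> R - {2}" by (auto simp: T_def)
    ultimately obtain P where P: "T \<subseteq> P" "P \<subseteq> R - {2}" "card P = k - 1"
      using exists_subset_between[of T "k - 1" "R - {2}"] fR by auto
    have fP: "finite P" using P(2) fR by (meson finite_Diff finite_subset)
    show ?thesis
    proof (rule bal_admissibleI[of n P "R - P"])
      have "card (R - P) = k - 2"
        using card_Diff_subset[OF fP, of R] P cR k3 by auto
      then show "card (R - P) + 1 < k" using k3 by simp
      \<comment> \<open>\<open>R - P\<close> plays the role of \<open>Q\<close> and contains
        2.\<close>
      have "{x \<in> {2..n}. \<forall>q\<in>R - P. \<not> q dvd x} \<subseteq> {x \<in> {2..n}. odd x}"
        using \<open>2 \<in> R\<close> P(2) by auto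
      from card_mono[OF _ this] show "card {x \<in> {2..n}. \<forall>q\<in>R - P. \<not> q dvd x} \<le> n div 2"
        using card_odd_from_2[of n] by simp
      have "{x \<in> {1..n}. 3 dvd x \<or> 5 dvd x \<or> 7 dvd x} \<subseteq> {x \<in> {1..n}. \<exists>p\<in>P. p dvd x}"
      proof -
        have "p \<in> P" if "p \<in> {3, 5, 7}" "p dvd x" "x \<in> {1..n}" for p x
        proof -
          have "p \<le> n" using that dvd_imp_le[of p x] by auto
          then have "p \<in> T" using that(1) pr by (auto simp: T_def R_def)
          then show ?thesis using P(1) by blast
        qed
        then show ?thesis by blast
      qed
      from card_mono[OF _ this] show "n div 2 \<le> card {x \<in> {1..n}. \<exists>p\<in>P. p dvd x}"
        using card_divisible_3_5_7[OF n5] by simp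
    qed (use n1 fP fR P k3 in \<open>auto simp: R_def\<close>)
  qed
  then show ?thesis by (simp add: n_def)
qed

section \<open>Upper bound\<close>

lemma bal_admissible_less_nth_prime:
  assumes "n \<in> bal_admissible k" "k \<ge> 2"
  shows "n < nth_prime (2 * k - 2)"
proof (rule ccontr)
  define q where "q = nth_prime (2 * k - 2)"
  assume "\<not> n < nth_prime (2 * k - 2)"
  then have "q \<le> n" by (simp add: q_def)
  obtain c :: "nat \<Rightarrow> bool" where c: "\<And>i. \<not> contains_pairwise_coprime k (color_class c n i)"
    using assms(1) unfolding bal_admissible_def by blast
  define R where "R = {p. prime p \<and> p < q}"
  have R: "finite R" "card R = 2 * k - 3"
    using card_primes_less_nth_prime[of "2 * k - 2"] by (simp_all add: R_def q_def)
  define W where "W = insert 1 (insert q R)"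
  have "prime q" unfolding q_def by (rule prime_nth_prime)
  have "q \<notin> R" "1 \<notin> insert q R"
    using \<open>prime q\<close> by (auto simp: R_def)
  then have W: "finite W" "card W = 2 * k - 1"
    using R assms(2) by (auto simp: W_def)
  have "pairwise coprime W"
    using \<open>prime q\<close> by (auto simp: W_def R_def pairwise_def primes_coprime)
  have Wn: "W \<subseteq> {1..n}"
    using \<open>q \<le> n\<close> \<open>prime q\<close> by (auto simp: W_def R_def dest: prime_ge_1_nat)
  have less: "card {x \<in> W. c x = i} < k" for i
  proof (rule ccontr)
    assume "\<not> card {x \<in> W. c x = i} < k"
    then obtain U where U: "U \<subseteq> {x \<in> W. c x = i}" "card U = k" "finite U"
      by (meson not_less obtain_subset_with_card_n)
    then have "U \<subseteq> color_class c n i" "pairwise coprime U"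
      using Wn pairwise_subset[OF \<open>pairwise coprime W\<close>, of U] by (auto simp: color_class_def)
    then show False
      using c U by (auto simp: contains_pairwise_coprime_def)
  qed
  \<comment> \<open>Pigeonhole: two parts of at most \<open>k - 1\<close> elements cannot make up
    the \<open>2 * k - 1\<close> elements of \<open>W\<close>.\<close>
  have "W = {x \<in> W. c x = True} \<union> {x \<in> W. c x = False}" by auto
  then have "card W \<le> card {x \<in> W. c x = True} + card {x \<in> W. c x = False}"
    by (metis card_Un_le)
  then show False using less[of True] less[of False] W(2) by linarith
qed

theorem theorem6p2:
  fixes k :: nat
  assumes "k \<ge> 2"
  shows "finite (bal_admissible k) \<and> bal_admissible k \<noteq> {} \<and>
         L_bal k = nth_prime (2 * k - 2) - 1"
proof -
  have le: "n \<le> nth_prime (2 * k - 2) - 1" if "n \<in> bal_admissible k" for n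
    using bal_admissible_less_nth_prime[OF that assms] by simp
  then have "finite (bal_admissible k)"
    by (meson finite_nat_set_iff_bounded_le)
  then show ?thesis
    using pred_nth_prime_bal_admissible[OF assms] le by (auto simp: L_bal_def intro: Max_eqI)
qed

end
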